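(* Let $n>0$ and $\alpha\ge 0$ be integers, and let $f$ be a polynomial function of $u\in\mathbb{Z}$ such that $f(u)$ is a positive integer for every $u\in\mathbb{Z}$. Write $f$ for $f(u)$. Suppose that, for all $u\in\mathbb{Z}$, $$f\equiv 0 \pmod{2^{\alpha-1}n}.$$ Let $$D=f^{2}\pm 2^{\alpha}n,$$ where $D$ is a positive integer that is not a perfect square. In the case of the minus sign, suppose also that $f^{2}>2^{\alpha}n$ and that $\alpha=0$, $n=1$ do not hold simultaneously. Then the convergent $p_r/q_r$ of the continued fraction of $\sqrt{D}$ that gives the fundamental solution $(X_1,Y_1)=(p_r,q_r)$ of the Pell equation $X^2-DY^2=1$ is $$\frac{p_r}{q_r}=\frac{\;\dfrac{f^{2}}{2^{\alpha-1}n}\pm 1\;}{\dfrac{f}{2^{\alpha-1}n}},$$ that is, $p_r=\dfrac{f^{2}}{2^{\alpha-1}n}\pm1$ and $q_r=\dfrac{f}{2^{\alpha-1}n}$, with the same choice of sign as in $D$.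
   Context: The congruence $f\equiv 0 \pmod{2^{\alpha-1}n}$ means that $f/(2^{\alpha-1}n)$ is an integer. For $\alpha=0$ this reads $2f\equiv 0\pmod n$. For a positive non-square integer $D$, the regular continued fraction of $\sqrt D$ is written $\sqrt D=[a_0;\overline{a_1,\dots,a_r,2a_0}]$ with $a_0=\lfloor\sqrt D\rfloor$, the bar indicating a period of length $r+1$. The convergents $p_i/q_i$ are given by $p_i=a_ip_{i-1}+p_{i-2}$, $q_i=a_iq_{i-1}+q_{i-2}$, with $p_{-1}=1$, $p_0=a_0$, $q_{-1}=0$, $q_0=1$. The fundamental solution $(X_1,Y_1)$ of $X^2-DY^2=1$ is the smallest solution in positive integers with $X_1>1$, $Y_1>0$. It is always of the form $(p_i,q_i)$, where $i+1$ is the least even (not necessarily least) period length of the continued fraction of $\sqrt{D}$. *)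

theory Defs
  imports Complex_Main "HOL-Computational_Algebra.Polynomial"
begin

fun complete_quotient :: "real \<Rightarrow> nat \<Rightarrow> real" where
  "complete_quotient x 0 = x"
| "complete_quotient x (Suc i) = 1 / frac (complete_quotient x i)"

text \<open>
  The partial quotients of the regular continued fraction of \<open>x\<close>. They are meaningful at all
  indices only for irrational \<open>x\<close>: for rational \<open>x\<close> the expansion would stop, whereas here it
  runs into \<open>1 / 0 = 0\<close>.
\<close>

definition partial_quotient :: "real \<Rightarrow> nat \<Rightarrow> int" where
  "partial_quotient x i = \<lfloor>complete_quotient x i\<rfloor>"

text \<open>
  The initial values with index \<open>-1\<close>, which are \<open>1\<close> for numerators and \<open>0\<close> for denominators,
  are built into the equations for index \<open>1\<close>.
\<close>

fun conv_num :: "real \<Rightarrow> nat \<Rightarrow> int" where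
  "conv_num x 0 = partial_quotient x 0"
| "conv_num x (Suc 0) = partial_quotient x 1 * conv_num x 0 + 1"
| "conv_num x (Suc (Suc i)) =
     partial_quotient x (Suc (Suc i)) * conv_num x (Suc i) + conv_num x i"

fun conv_denom :: "real \<Rightarrow> nat \<Rightarrow> int" where
  "conv_denom x 0 = 1"
| "conv_denom x (Suc 0) = partial_quotient x 1 * conv_denom x 0 + 0"
| "conv_denom x (Suc (Suc i)) =
     partial_quotient x (Suc (Suc i)) * conv_denom x (Suc i) + conv_denom x i"

text \<open>
  \<open>l\<close> is a period length, not necessarily the least one, of the expansion
  \<open>sqrt D = [a 0; a 1, \<dots>, a (l - 1), 2 * a 0, \<dots>]\<close>, whose period starts at index \<open>1\<close>.
\<close>

definition sqrt_period_length :: "int \<Rightarrow> nat \<Rightarrow> bool" where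
  "sqrt_period_length D l \<longleftrightarrow>
     l > 0 \<and>
     partial_quotient (sqrt (of_int D)) l = 2 * partial_quotient (sqrt (of_int D)) 0 \<and>
     (\<forall>i\<ge>1. partial_quotient (sqrt (of_int D)) (i + l) = partial_quotient (sqrt (of_int D)) i)"

definition least_even_period_length :: "int \<Rightarrow> nat \<Rightarrow> bool" where
  "least_even_period_length D l \<longleftrightarrow>
     even l \<and> sqrt_period_length D l \<and>
     (\<forall>l'. even l' \<and> sqrt_period_length D l' \<longrightarrow> l \<le> l')"

definition pell_solution :: "int \<Rightarrow> int \<Rightarrow> int \<Rightarrow> bool" where
  "pell_solution D X Y \<longleftrightarrow> X\<^sup>2 - D * Y\<^sup>2 = 1 \<and> X > 1 \<and> Y > 0"

definition fundamental_solution :: "int \<Rightarrow> int \<Rightarrow> int \<Rightarrow> bool" where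
  "fundamental_solution D X Y \<longleftrightarrow>
     pell_solution D X Y \<and> (\<forall>X' Y'. pell_solution D X' Y' \<longrightarrow> X \<le> X' \<and> Y \<le> Y')"

end

theory Submission imports Defs begin

text \<open>
  Put \<open>N = 2\<^sup>\<alpha>n\<close> and \<open>F = f(u)\<close>; the congruence says \<open>2F = Nk\<close> with a positive integer \<open>k\<close>, and
  \<open>(kF \<plusminus> 1, k)\<close> solves the Pell equation for \<open>D = F\<^sup>2 \<plusminus> N\<close>. It is minimal because every solution
  \<open>(X, Y)\<close> has \<open>X \<ge> FY + 1\<close> (respectively \<open>X \<le> FY - 1\<close>, as \<open>N \<ge> 2\<close>), and squaring gives \<open>Y \<ge> k\<close>.
  The expansions are \<open>\<surd>(F\<^sup>2 + N) = [F; k, 2F]\<close> and, for \<open>k \<ge> 3\<close>,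
  \<open>\<surd>(F\<^sup>2 - N) = [F - 1; 1, k - 2, 1, 2F - 2]\<close>. For \<open>k = 1\<close> and \<open>k = 2\<close> the number \<open>F\<^sup>2 - N\<close> equals
  \<open>(F - 2)\<^sup>2 + 2(F - 2)\<close> and \<open>(F - 1)\<^sup>2 + (F - 1)\<close>, which is again of the first type.
\<close>

text \<open>The reciprocal is given through the product \<open>z * (y - of_int a) = 1\<close>, so
  each step of an expansion amounts to checking an identity between surds.\<close>

lemma complete_quotient_Suc_eqI:
  assumes "complete_quotient x i = y" "of_int a < y" "y < of_int a + 1"
    "z * (y - of_int a) = 1"
  shows "partial_quotient x i = a" "complete_quotient x (Suc i) = z"
proof -
  have a: "\<lfloor>y\<rfloor> = a"
    using assms(2,3) by linarith
  then show "partial_quotient x i = a"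
    by (simp add: partial_quotient_def assms(1))
  show "complete_quotient x (Suc i) = z"
    using assms(2,4) by (simp add: assms(1) frac_def a field_simps)
qed

text \<open>A complete quotient that differs from the square root by an integer has the same
  fractional part, so its successor is complete quotient 1 and everything from index 1 on repeats.
  As the integer is the initial partial quotient, the floor at index \<open>l\<close> is twice that
  quotient.\<close>

lemma sqrt_period_lengthI:
  assumes "l > 0"
    and l: "complete_quotient (sqrt (of_int D)) l
          = sqrt (of_int D) + of_int (partial_quotient (sqrt (of_int D)) 0)"
  shows "sqrt_period_length D l"
proof -
  let ?s = "sqrt (of_int D)"
  have "complete_quotient ?s (Suc i + l) = complete_quotient ?s (Suc i)" for i
  proof (induction i)
    case 0
    then show ?case
      using l by (simp add: frac_def)
  next
    case (Suc i)
    then show ?case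
      by (metis add_Suc complete_quotient.simps(2))
  qed
  then have "partial_quotient ?s (i + l) = partial_quotient ?s i" if "i \<ge> 1" for i
    using that by (cases i) (simp_all add: partial_quotient_def)
  moreover have "partial_quotient ?s l = 2 * partial_quotient ?s 0"
    using l by (simp add: partial_quotient_def)
  ultimately show ?thesis
    using \<open>l > 0\<close> by (simp add: sqrt_period_length_def)
qed

lemma least_even_period_length_2:
  assumes "sqrt_period_length D 2"
  shows "least_even_period_length D 2"
  unfolding least_even_period_length_def
proof (intro conjI allI impI)
  fix l' :: nat
  assume "even l' \<and> sqrt_period_length D l'"
  then show "2 \<le> l'"
    by (auto simp: sqrt_period_length_def elim!: evenE)
qed (use assms in auto)

text \<open>Period length 2 would force the partial quotient at index 2 to be twice the initial one;
  excluding this leaves 4 as the smallest even candidate.\<close>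

lemma least_even_period_length_4:
  assumes "sqrt_period_length D 4"
    and "partial_quotient (sqrt (of_int D)) 2 \<noteq> 2 * partial_quotient (sqrt (of_int D)) 0"
  shows "least_even_period_length D 4"
  unfolding least_even_period_length_def
proof (intro conjI allI impI)
  fix l' :: nat
  assume l': "even l' \<and> sqrt_period_length D l'"
  then have "l' \<noteq> 2" "l' > 0"
    using assms(2) by (auto simp: sqrt_period_length_def)
  with l' show "4 \<le> l'"
    by (auto elim!: evenE)
qed (use assms in auto)

text \<open>The complete quotients are \<open>s\<close>, \<open>(s + a) / c\<close>,
  \<open>s + a\<close>. The parameters stay independent of \<open>F\<close>, \<open>N\<close>,
  \<open>k\<close> because the minus sign with \<open>k = 1\<close> or \<open>k = 2\<close> also
  uses this lemma, with \<open>a\<close> equal to \<open>F - 2\<close> or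
  \<open>F - 1\<close>.\<close>

lemma sqrt_expansion_period_2:
  fixes a b c D :: int
  assumes "a > 0" "c > 0" and cb: "c * b = 2 * a" and D: "D = a\<^sup>2 + c"
  shows "least_even_period_length D 2"
    and "conv_num (sqrt (of_int D)) 1 = b * a + 1"
    and "conv_denom (sqrt (of_int D)) 1 = b"
proof -
  define s :: real where "s = sqrt (of_int D)"
  have "b > 0"
    using cb assms(1,2) zero_less_mult_pos[of c b] by simp
  \<comment> \<open>This bound gives \<open>D < (a + 1)\<^sup>2\<close>, hence floor
    \<open>a\<close> for \<open>s\<close>.\<close>
  then have "c \<le> 2 * a"
    using mult_left_mono[of 1 b c] cb \<open>c > 0\<close> by simp
  have "D \<ge> 0"
    using D \<open>c > 0\<close> by simp
  then have "s\<^sup>2 = of_int D"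
    by (simp add: s_def)
  then have s2: "s\<^sup>2 = (of_int a)\<^sup>2 + of_int c"
    by (simp add: D)
  have "s \<ge> 0"
    using \<open>D \<ge> 0\<close> by (simp add: s_def)
  have "s > of_int a"
    using s2 \<open>s \<ge> 0\<close> \<open>c > 0\<close> by (intro power2_less_imp_less[of "of_int a" s]) auto
  have "s\<^sup>2 < (of_int a + 1)\<^sup>2"
    using \<open>c \<le> 2 * a\<close> unfolding s2 by (simp add: power2_sum)
  then have "s < of_int a + 1"
    using \<open>a > 0\<close> by (intro power2_less_imp_less[of s]) auto
  have cb': "of_int c * of_int b = 2 * (of_int a :: real)"
    using cb by (metis of_int_mult of_int_numeral)
  \<comment> \<open>Since \<open>c * b = 2 * a\<close>, subtracting \<open>b\<close> turns
    \<open>s + a\<close> into its conjugate \<open>s - a\<close>, and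
    \<open>(s + a) * (s - a) = c\<close> then yields the next complete quotient
    \<open>s + a\<close>.\<close>
  have b: "(s + of_int a) / of_int c - of_int b = (s - of_int a) / of_int c"
    using cb' \<open>c > 0\<close> by (simp add: field_simps)
  have prod: "(s + of_int a) * (s - of_int a) = of_int c"
    using s2 by (simp add: algebra_simps power2_eq_square)
  have q0: "partial_quotient s 0 = a" "complete_quotient s (Suc 0) = (s + of_int a) / of_int c"
    using complete_quotient_Suc_eqI[of s 0 s a "(s + of_int a) / of_int c"]
      \<open>s > of_int a\<close> \<open>s < of_int a + 1\<close> prod \<open>c > 0\<close> by simp_all
  have "1 \<le> real_of_int c"
    using \<open>c > 0\<close> by simp
  then have "(s - of_int a) / of_int c < 1"
    using \<open>s < of_int a + 1\<close> \<open>1 \<le> real_of_int c\<close> by (simp add: field_simps)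
  moreover have "(s - of_int a) / of_int c > 0"
    using \<open>s > of_int a\<close> \<open>c > 0\<close> by simp
  moreover have "(s + of_int a) * ((s + of_int a) / of_int c - of_int b) = 1"
    unfolding b using prod \<open>c > 0\<close> by simp
  ultimately have q1: "partial_quotient s (Suc 0) = b" 
      "complete_quotient s (Suc (Suc 0)) = s + of_int a"
    using complete_quotient_Suc_eqI[OF q0(2), of b "s + of_int a"] b by linarith+
  have "sqrt_period_length D 2"
    using q0(1) q1(2) by (intro sqrt_period_lengthI) (simp_all add: s_def numeral_2_eq_2)
  then show "least_even_period_length D 2"
    by (rule least_even_period_length_2)
  show "conv_num (sqrt (of_int D)) 1 = b * a + 1" "conv_denom (sqrt (of_int D)) 1 = b"
    using q0(1) q1(1) by (simp_all add: s_def)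
qed

text \<open>With \<open>t = F - s\<close> and \<open>w = t / N\<close>, both in (0, 1/2), the
  complete quotients are \<open>s\<close>, \<open>1 / (1 - t)\<close>, \<open>k - w - 1\<close>,
  \<open>1 / (1 - w)\<close>, \<open>s + F - 1\<close>. The steps rest on the two relations
  \<open>(s + F) * w = 1\<close> and \<open>(k - w) * t = 1\<close>.\<close>

lemma sqrt_expansion_period_4:
  fixes F N k D :: int
  assumes "N \<ge> 2" "k \<ge> 3" and Nk: "N * k = 2 * F" and D: "D = F\<^sup>2 - N"
  shows "least_even_period_length D 4"
    and "conv_num (sqrt (of_int D)) 3 = k * F - 1"
    and "conv_denom (sqrt (of_int D)) 3 = k"
proof -
  define s :: real where "s = sqrt (of_int D)"
  define t where "t = of_int F - s"
  define w where "w = t / of_int N"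
  have "3 * N \<le> N * k"
    using mult_left_mono[OF \<open>k \<ge> 3\<close>, of N] \<open>N \<ge> 2\<close> by simp
  then have F: "3 * N \<le> 2 * F"
    using Nk by simp
  then have F': "3 * real_of_int N \<le> 2 * real_of_int F"
    by linarith
  have "F \<ge> 1"
    using F \<open>N \<ge> 2\<close> by simp
  have "F * 1 \<le> F * F"
    by (rule mult_left_mono) (use \<open>F \<ge> 1\<close> in auto)
  moreover have "F * 3 \<le> F * F"
    by (rule mult_left_mono) (use F \<open>N \<ge> 2\<close> in auto)
  ultimately have "D \<ge> 0"
    using F \<open>N \<ge> 2\<close> unfolding D power2_eq_square by linarith
  then have s2: "s\<^sup>2 = (of_int F)\<^sup>2 - of_int N"
    by (simp add: s_def D)
  have "s \<ge> 0"
    using \<open>D \<ge> 0\<close> by (simp add: s_def)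
  have "s < of_int F"
    using s2 \<open>F \<ge> 1\<close> \<open>N \<ge> 2\<close> by (intro power2_less_imp_less[of s "of_int F"]) auto
  then have "t > 0"
    by (simp add: t_def)
  \<comment> \<open>The bound 1/2 on \<open>t\<close> puts \<open>1 / (1 - t)\<close> between 1 and
    2. The inequality says \<open>N + 1/4 < F\<close>, which follows from
    \<open>3 * N \<le> 2 * F\<close> and \<open>N \<ge> 2\<close>.\<close>
  have "(of_int F - 1 / 2)\<^sup>2 < s\<^sup>2"
    unfolding s2 power2_diff using F' \<open>N \<ge> 2\<close> by (simp add: power2_eq_square)
  then have "of_int F - 1 / 2 < s"
    using \<open>s \<ge> 0\<close> by (rule power2_less_imp_less)
  then have "t < 1 / 2"
    by (simp add: t_def)
  have Nk': "of_int N * of_int k = 2 * (of_int F :: real)"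
    using Nk by (metis of_int_mult of_int_numeral)
  have "(s + of_int F) * t = of_int N"
    using s2 by (simp add: t_def algebra_simps power2_eq_square)
  then have prod: "(s + of_int F) * w = 1"
    using \<open>N \<ge> 2\<close> by (simp add: w_def)
  have "w > 0"
    using \<open>t > 0\<close> \<open>N \<ge> 2\<close> by (simp add: w_def)
  have "w \<le> t / 1"
    unfolding w_def using \<open>t > 0\<close> \<open>N \<ge> 2\<close> by (intro divide_left_mono) auto
  then have "w < 1 / 2"
    using \<open>t < 1 / 2\<close> by simp
  \<comment> \<open>Here \<open>s + F = 2 * F - t\<close>, and \<open>2 * F = N * k\<close>.\<close>
  have "(s + of_int F) / of_int N = of_int k - w"
    using Nk' \<open>N \<ge> 2\<close> by (simp add: w_def t_def field_simps)
  moreover have "(s + of_int F) / of_int N * t = 1"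
    using \<open>(s + of_int F) * t = of_int N\<close> \<open>N \<ge> 2\<close> by simp
  ultimately have kt: "(of_int k - w) * t = 1"
    by simp
  have q0: "partial_quotient s 0 = F - 1" "complete_quotient s (Suc 0) = 1 / (1 - t)"
    using complete_quotient_Suc_eqI[of s 0 s "F - 1" "1 / (1 - t)"] \<open>t > 0\<close> \<open>t < 1 / 2\<close>
    by (simp_all add: t_def)
  have floor1: "of_int 1 < 1 / (1 - x)" "1 / (1 - x) < of_int 1 + 1"
    if "0 < x" "x < 1 / 2" for x :: real
    using that by (simp_all add: field_simps)
  \<comment> \<open>As \<open>1 / (1 - t) - 1 = t / (1 - t)\<close>, this is
    \<open>(k - w) * t = 1\<close> rearranged.\<close>
  have "(of_int k - w - 1) * (1 / (1 - t) - of_int 1) = 1"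
    using kt \<open>t < 1 / 2\<close> by (simp add: field_simps)
  then have q1: "partial_quotient s (Suc 0) = 1"
      "complete_quotient s (Suc (Suc 0)) = of_int k - w - 1"
    by (rule complete_quotient_Suc_eqI[OF q0(2) floor1[OF \<open>t > 0\<close> \<open>t < 1 / 2\<close>]])+
  have q2: "partial_quotient s (Suc (Suc 0)) = k - 2"
      "complete_quotient s (Suc (Suc (Suc 0))) = 1 / (1 - w)"
    using complete_quotient_Suc_eqI[OF q1(2), of "k - 2" "1 / (1 - w)"] \<open>w > 0\<close> \<open>w < 1 / 2\<close>
    by simp_all
  \<comment> \<open>The same rearrangement, now of \<open>(s + F) * w = 1\<close>.\<close>
  have "(s + of_int (F - 1)) * (1 / (1 - w) - of_int 1) = 1"
    using prod \<open>w < 1 / 2\<close> by (simp add: field_simps)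
  then have q3: "partial_quotient s (Suc (Suc (Suc 0))) = 1"
      "complete_quotient s (Suc (Suc (Suc (Suc 0)))) = s + of_int (F - 1)"
    by (rule complete_quotient_Suc_eqI[OF q2(2) floor1[OF \<open>w > 0\<close> \<open>w < 1 / 2\<close>]])+
  have "sqrt_period_length D 4"
    using q0(1) q3(2) by (intro sqrt_period_lengthI) (simp_all add: s_def eval_nat_numeral)
  \<comment> \<open>This leads to \<open>k < 2 * F\<close>, so the partial quotient
    \<open>k - 2\<close> at index 2 differs from \<open>2 * (F - 1)\<close> and length 2 is ruled
    out.\<close>
  moreover have "2 * k \<le> N * k"
    by (rule mult_right_mono) (use assms in auto)
  then have "k < 2 * F"
    using Nk \<open>k \<ge> 3\<close> by linarith
  ultimately show "least_even_period_length D 4"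
    using q0(1) q2(1) by (intro least_even_period_length_4) (simp_all add: s_def numeral_2_eq_2)
  note q = q0(1) q1(1) q2(1) q3(1)
  show "conv_num (sqrt (of_int D)) 3 = k * F - 1"
    using q by (simp add: numeral_3_eq_3 flip: s_def) (simp add: algebra_simps)
  show "conv_denom (sqrt (of_int D)) 3 = k"
    using q by (simp add: numeral_3_eq_3 flip: s_def)
qed

text \<open>Minimality of \<open>Y\<close> suffices: for \<open>D > 0\<close> the value
  \<open>X\<^sup>2 = 1 + D * Y\<^sup>2\<close> grows with \<open>Y\<close>. It also exceeds 1 when
  \<open>Y > 0\<close>, so \<open>X > 1\<close> follows from \<open>X \<ge> 0\<close>.\<close>

lemma fundamental_solutionI:
  assumes "D > 0" and sol: "X\<^sup>2 - D * Y\<^sup>2 = 1" and "X \<ge> 0" "Y > 0"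
    and min: "\<And>X' Y'. pell_solution D X' Y' \<Longrightarrow> Y \<le> Y'"
  shows "fundamental_solution D X Y"
proof -
  have "D * Y\<^sup>2 > 0"
    using assms by simp
  then have "1\<^sup>2 < X\<^sup>2"
    using sol by simp
  then have "X > 1"
    using \<open>X \<ge> 0\<close> by (rule power2_less_imp_less)
  moreover have "X \<le> X'" if p: "pell_solution D X' Y'" for X' Y'
  proof (rule power2_le_imp_le)
    have "D * Y\<^sup>2 \<le> D * Y'\<^sup>2"
      using \<open>D > 0\<close> \<open>Y > 0\<close> min[OF p] by (intro mult_left_mono power_mono) auto
    then show "X\<^sup>2 \<le> X'\<^sup>2" "0 \<le> X'"
      using sol p by (auto simp: pell_solution_def)
  qed
  ultimately show ?thesis
    using sol \<open>Y > 0\<close> min by (simp add: fundamental_solution_def) (simp add: pell_solution_def)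
qed

lemma fundamental_solution_square_plus_minus:
  fixes F N k \<epsilon> D :: int
  assumes "F > 0" "N > 0" "k > 0" and Nk: "N * k = 2 * F"
    and \<epsilon>: "\<epsilon> = 1 \<or> \<epsilon> = -1 \<and> N \<ge> 2"
    and D: "D = F\<^sup>2 + \<epsilon> * N" "D > 0"
  shows "fundamental_solution D (k * F + \<epsilon>) k"
proof (rule fundamental_solutionI)
  have "(k * F + \<epsilon>)\<^sup>2 - D * k\<^sup>2 = \<epsilon>\<^sup>2 + \<epsilon> * k * (2 * F - N * k)"
    unfolding D by (simp add: algebra_simps power2_eq_square)
  then show "(k * F + \<epsilon>)\<^sup>2 - D * k\<^sup>2 = 1"
    using \<epsilon> Nk by auto
  show "k * F + \<epsilon> \<ge> 0"
    using \<epsilon> mult_pos_pos[OF \<open>k > 0\<close> \<open>F > 0\<close>] by auto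
next
  fix X Y
  assume "pell_solution D X Y"
  then have "X > 1" "Y > 0" and X2: "X\<^sup>2 = (F * Y)\<^sup>2 + \<epsilon> * (N * Y\<^sup>2) + 1"
    by (auto simp: pell_solution_def D algebra_simps)
  have "F * Y > 0"
    using \<open>F > 0\<close> \<open>Y > 0\<close> by simp
  \<comment> \<open>Both signs lead to this one inequality: comparing \<open>X\<^sup>2\<close> with
    the square of \<open>F * Y + \<epsilon>\<close> cancels the remaining terms. With
    \<open>2 * F = N * k\<close>, dividing by \<open>N * Y\<close> leaves
    \<open>k \<le> Y\<close>.\<close>
  have "2 * (F * Y) \<le> N * Y\<^sup>2"
  proof (cases "\<epsilon> = 1")
    case True
    have "(F * Y)\<^sup>2 < X\<^sup>2"
      using X2 True mult_pos_pos[OF \<open>N > 0\<close>, of "Y\<^sup>2"] \<open>Y > 0\<close> by simp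
    then have "F * Y < X"
      by (rule power2_less_imp_less) (use \<open>X > 1\<close> in simp)
    then have "(F * Y + 1)\<^sup>2 \<le> X\<^sup>2"
      using \<open>F * Y > 0\<close> by (intro power_mono) auto
    then show ?thesis
      using X2 True by (simp add: power2_sum)
  next
    case False
    then have "N \<ge> 2" "\<epsilon> = -1"
      using \<epsilon> by auto
    \<comment> \<open>The subtracted \<open>N * Y\<^sup>2\<close> must outweigh the constant 1 in
      \<open>X2\<close> to make \<open>X\<close> strictly smaller than \<open>F * Y\<close>.\<close>
    have "2 * 1 \<le> N * Y\<^sup>2"
      using \<open>N \<ge> 2\<close> \<open>Y > 0\<close> by (intro mult_mono) (auto simp: int_one_le_iff_zero_less)
    then have "X\<^sup>2 < (F * Y)\<^sup>2"
      using X2 \<open>\<epsilon> = -1\<close> by simp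
    then have "X < F * Y"
      by (rule power2_less_imp_less) (use \<open>F * Y > 0\<close> in simp)
    then have "X\<^sup>2 \<le> (F * Y - 1)\<^sup>2"
      using \<open>X > 1\<close> by (intro power_mono) auto
    then show ?thesis
      using X2 \<open>\<epsilon> = -1\<close> by (simp add: power2_diff)
  qed
  also have "2 * (F * Y) = (N * Y) * k"
    using Nk by (simp add: algebra_simps)
  also have "N * Y\<^sup>2 = (N * Y) * Y"
    by (simp add: power2_eq_square)
  finally show "k \<le> Y"
    using \<open>N > 0\<close> \<open>Y > 0\<close> by simp
qed (use assms in auto)

theorem theorem1:
  fixes n :: int and \<alpha> :: nat and f :: "int \<Rightarrow> int" and P :: "real poly"
    and \<epsilon> u D :: int
  assumes "n > 0"
    and "\<And>v. real_of_int (f v) = poly P (real_of_int v)"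
    and "\<And>v. f v > 0"
    and "\<And>v. real_of_int (f v) / (2 powi (int \<alpha> - 1) * real_of_int n) \<in> \<int>"
    and "\<epsilon> = 1 \<or> \<epsilon> = -1"
    and "D = (f u)\<^sup>2 + \<epsilon> * (2 ^ \<alpha> * n)"
    and "D > 0"
    and "\<nexists>k. D = k\<^sup>2"
    and "\<epsilon> = -1 \<Longrightarrow> (f u)\<^sup>2 > 2 ^ \<alpha> * n"
    and "\<epsilon> = -1 \<Longrightarrow> \<not> (\<alpha> = 0 \<and> n = 1)"
  shows "\<exists>r. least_even_period_length D (r + 1) \<and>
           fundamental_solution D (conv_num (sqrt (of_int D)) r) (conv_denom (sqrt (of_int D)) r) \<and>
           real_of_int (conv_num (sqrt (of_int D)) r) =
             real_of_int ((f u)\<^sup>2) / (2 powi (int \<alpha> - 1) * real_of_int n) + real_of_int \<epsilon> \<and>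
           real_of_int (conv_denom (sqrt (of_int D)) r) =
             real_of_int (f u) / (2 powi (int \<alpha> - 1) * real_of_int n)"
proof -
  define F N where "F = f u" and "N = 2 ^ \<alpha> * n"
  have "F > 0" "N > 0"
    using assms(1,3) by (simp_all add: F_def N_def)
  have D: "D = F\<^sup>2 + \<epsilon> * N"
    using assms(6) by (simp add: F_def N_def)
  \<comment> \<open>Written as \<open>N / 2\<close>, the modulus needs no separate treatment of the
    negative exponent at \<open>\<alpha> = 0\<close>.\<close>
  have m: "2 powi (int \<alpha> - 1) * real_of_int n = of_int N / 2"
    by (simp add: N_def power_int_diff)
  obtain k where k: "real_of_int F / (of_int N / 2) = of_int k"
    using assms(4)[of u] unfolding m F_def by (auto elim: Ints_cases)
  have "of_int (N * k) = real_of_int (2 * F)"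
    using k \<open>N > 0\<close> by (simp add: field_simps)
  then have Nk: "N * k = 2 * F"
    using of_int_eq_iff by blast
  have "k > 0"
    using Nk \<open>F > 0\<close> \<open>N > 0\<close> zero_less_mult_pos[of N k] by simp
  \<comment> \<open>The excluded pair \<open>\<alpha> = 0\<close>, \<open>n = 1\<close> is exactly
    the case \<open>N = 1\<close>.\<close>
  have "N \<ge> 2" if "\<epsilon> = -1"
  proof (rule ccontr)
    assume "\<not> N \<ge> 2"
    with \<open>N > 0\<close> have "2 ^ \<alpha> * n = 1"
      by (simp add: N_def)
    then have "2 ^ \<alpha> = (1 :: int)" "n = 1"
      using zmult_eq_1_iff[of "2 ^ \<alpha>" n] assms(1) by auto
    then have "\<alpha> = 0"
      using power_inject_exp[of "2 :: int" \<alpha> 0] by simp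
    with \<open>n = 1\<close> assms(10) that show False
      by simp
  qed
  then have \<epsilon>: "\<epsilon> = 1 \<or> \<epsilon> = -1 \<and> N \<ge> 2"
    using assms(5) by auto
  have fund: "fundamental_solution D (k * F + \<epsilon>) k"
    using fundamental_solution_square_plus_minus[OF \<open>F > 0\<close> \<open>N > 0\<close> \<open>k > 0\<close> Nk \<epsilon> D assms(7)] .
  have "\<exists>r. least_even_period_length D (r + 1) \<and>
      conv_num (sqrt (of_int D)) r = k * F + \<epsilon> \<and> conv_denom (sqrt (of_int D)) r = k"
  proof -
    \<comment> \<open>For the minus sign, \<open>k - 2\<close> can serve as a partial quotient only
      if \<open>k \<ge> 3\<close>; smaller \<open>k\<close> fall back on period length 2. The index
      \<open>r\<close> is one less than the period length, so 1 or 3.\<close>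
    consider "\<epsilon> = 1" | "\<epsilon> = -1" "k = 1" | "\<epsilon> = -1" "k = 2" | "\<epsilon> = -1" "k \<ge> 3"
      using \<epsilon> \<open>k > 0\<close> by linarith
    then show ?thesis
    proof cases
      case 1
      then show ?thesis
        using sqrt_expansion_period_2[OF \<open>F > 0\<close> \<open>N > 0\<close> Nk, of D] D
        by (intro exI[of _ 1]) (simp del: One_nat_def)
    next
      case 2
      \<comment> \<open>Here \<open>N = 2 * F\<close>. Taking \<open>a = F - 2\<close>,
        \<open>c = 2 * a\<close>, \<open>b = 1\<close> gives the numerator
        \<open>a + 1 = F - 1\<close>, as required.\<close>
      then have D': "D = (F - 2) * F"
        using D Nk by (simp add: algebra_simps power2_eq_square)
      then have "F - 2 > 0"
        using assms(7) \<open>F > 0\<close> by (simp add: zero_less_mult_iff)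
      moreover have D: "D = (F - 2)\<^sup>2 + 2 * (F - 2)"
        unfolding D' by (simp add: algebra_simps power2_eq_square)
      ultimately show ?thesis
        using sqrt_expansion_period_2[OF _ _ _ D, where b = 1] 2
        by (intro exI[of _ 1]) (simp del: One_nat_def)
    next
      case 3
      \<comment> \<open>Here \<open>N = F\<close>. Taking \<open>a = c = F - 1\<close>,
        \<open>b = 2\<close> gives the numerator \<open>2 * a + 1 = 2 * F - 1\<close>.\<close>
      then have D': "D = (F - 1) * F"
        using D Nk by (simp add: algebra_simps power2_eq_square)
      then have "F - 1 > 0"
        using assms(7) \<open>F > 0\<close> by (simp add: zero_less_mult_iff)
      moreover have D: "D = (F - 1)\<^sup>2 + (F - 1)"
        unfolding D' by (simp add: algebra_simps power2_eq_square)
      ultimately show ?thesis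
        using sqrt_expansion_period_2[OF _ _ _ D, where b = 2] 3
        by (intro exI[of _ 1]) (simp del: One_nat_def)
    next
      case 4
      then show ?thesis
        using sqrt_expansion_period_4[of N k F D] Nk D \<epsilon>
        by (intro exI[of _ 3]) simp
    qed
  qed
  then obtain r where r: "least_even_period_length D (r + 1)"
      "conv_num (sqrt (of_int D)) r = k * F + \<epsilon>" "conv_denom (sqrt (of_int D)) r = k"
    by blast
  have "real_of_int (F\<^sup>2) / (of_int N / 2) = of_int (k * F)"
    using k \<open>N > 0\<close> by (simp add: field_simps power2_eq_square)
  then show ?thesis
    using r fund k unfolding m F_def[symmetric] by (intro exI[of _ r]) simp
qed

end
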